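(* Let $X$ and $Y$ be Banach spaces, let $\pi:X\to Y$ be a nonlinear operator of the form $\pi(x)=\ell_0+\pi_0(x)+F(x)$, where $\ell_0\in Y$, $\pi_0:X\to Y$ is a bounded linear operator and $F:X\to Y$ is a (possibly nonlinear) map. Let $K\neq\emptyset$ be a subset of $X$. Then, for all $n,m\in\mathbb N$ with $n,m\ge 1$, $$d_{n+m}(\pi(K))_Y\le \|\pi_0\|\, d_n(K)_X+D_m(F(K))_Y .$$
   Context: Banach spaces are over a common scalar field, $\mathbb R$ or $\mathbb C$. $\|\pi_0\|=\sup_{x\ne 0}\|\pi_0(x)\|_Y/\|x\|_X$ is the operator norm. For a Banach space $Z$, $\mathcal L_n(Z)$ denotes the set of all linear subspaces of $Z$ of dimension at most $n$, and $\mathrm{Aff}_n(Z)$ denotes the set of all affine subspaces of $Z$ of dimension at most $n$, i.e. sets $W=c+W_0$ with $c\in Z$ and $W_0\in\mathcal L_n(Z)$. For a nonempty set $S\subset Z$ and $n\ge1$, the Kolmogorov $n$-width and the affine Kolmogorov $n$-width are $$D_n(S)_Z=\inf_{W\in \mathcal L_n(Z)}\ \sup_{x\in S}\ \inf_{\xi\in W}\|x-\xi\|_Z,\qquad d_n(S)_Z=\inf_{W\in \mathrm{Aff}_n(Z)}\ \sup_{x\in S}\ \inf_{\xi\in W}\|x-\xi\|_Z .$$ These widths take values in $[0,\infty]$, with the convention $0\cdot\infty=0$. *)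

theory Defs
  imports "HOL-Analysis.Analysis"
begin

(* Banach space over a scalar field 'k, which is R or C: by the Gelfand-Mazur theorem the
   instances of real_normed_field are, up to isometric isomorphism, exactly real and complex.
   The library has no class of complex Banach spaces, so the scalar multiplication is explicit;
   its restriction to real scalars is the scaleR underlying the class banach. *)
locale banach_over = vector_space scl
  for scl :: "'k::real_normed_field \<Rightarrow> 'z::banach \<Rightarrow> 'z" +
  assumes norm_scl: "norm (scl c x) = norm c * norm x"
    and scl_of_real: "scl (of_real r) x = r *\<^sub>R x"

lemma banach_over_scaleR: "banach_over (scaleR :: real \<Rightarrow> 'z::banach \<Rightarrow> 'z)"
  by unfold_locales (auto simp: algebra_simps)

lemma banach_over_complex: "banach_over ((*) :: complex \<Rightarrow> complex \<Rightarrow> complex)"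
  by unfold_locales (auto simp: algebra_simps norm_mult scaleR_conv_of_real)

(* Finite-dimensionality is required separately, because the library's dim is 0 on
   infinite-dimensional spaces. *)
definition lin_subspaces :: "('k::real_normed_field \<Rightarrow> 'z::banach \<Rightarrow> 'z) \<Rightarrow> nat \<Rightarrow> 'z set set"
  where "lin_subspaces scl n =
    {W. module.subspace scl W \<and> (\<exists>B. finite B \<and> module.span scl B = W) \<and>
        vector_space.dim scl W \<le> n}"

definition aff_subspaces :: "('k::real_normed_field \<Rightarrow> 'z::banach \<Rightarrow> 'z) \<Rightarrow> nat \<Rightarrow> 'z set set"
  where "aff_subspaces scl n = {(+) c ` W0 | c W0. W0 \<in> lin_subspaces scl n}"

definition kolmogorov_width ::
    "('k::real_normed_field \<Rightarrow> 'z::banach \<Rightarrow> 'z) \<Rightarrow> nat \<Rightarrow> 'z set \<Rightarrow> ennreal"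
  where "kolmogorov_width scl n S =
    (INF W \<in> lin_subspaces scl n. SUP x \<in> S. INF \<xi> \<in> W. ennreal (norm (x - \<xi>)))"

definition affine_kolmogorov_width ::
    "('k::real_normed_field \<Rightarrow> 'z::banach \<Rightarrow> 'z) \<Rightarrow> nat \<Rightarrow> 'z set \<Rightarrow> ennreal"
  where "affine_kolmogorov_width scl n S =
    (INF W \<in> aff_subspaces scl n. SUP x \<in> S. INF \<xi> \<in> W. ennreal (norm (x - \<xi>)))"

end

theory Submission imports Defs begin

text \<open>Fix competitors \<open>W = c + W0\<close> for \<open>K\<close> and \<open>V\<close> for
  \<open>F\<close> K\<open>. The affine map\<close>\<xi> \<mapsto> l0 + \<pi>0
  \<xi>\<open>carries\<close>W\<open>to a translate of\<close>\<pi>0 \<open>W0\<close>, and adding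
  \<open>V\<close> gives an affine space \<open>U\<close> of dimension at most \<open>n + m\<close>
  (\<open>lin_subspaces_image\<close>, \<open>lin_subspaces_sum\<close>). For \<open>\<xi>\<close>
  in \<open>W\<close> and \<open>\<eta>\<close> in \<open>V\<close>, the error of approximating
  \<open>\<pi> x\<close> by \<open>l0 + \<pi>0 \<xi> + \<eta>\<close> is
  \<open>\<pi>0 (x - \<xi>) + (F x - \<eta>)\<close>, so the triangle inequality and the operator
  norm bound it by two independent errors. Since \<open>\<xi>\<close> and \<open>\<eta>\<close> vary
  independently, infima over both split this bound for each \<open>x\<close>; \<open>U\<close> does
  not depend on \<open>x\<close>, so suprema over \<open>K\<close> follow, and then infima over
  \<open>W\<close> and \<open>V\<close>. Both passages to infima use
  \<open>le_mult_INF_add_INF_ennreal\<close>.\<close>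

text \<open>Multiplication by a nonzero finite \<open>c\<close> is undone by division, which gives
  the nontrivial inequality. For \<open>c = 0\<close> nonemptiness matters: the empty infimum is
  infinite, while 0 times it is 0.\<close>

lemma INF_mult_left_ennreal:
  fixes c :: ennreal
  assumes "A \<noteq> {}" and "c \<noteq> top"
  shows "(INF x\<in>A. c * f x) = c * (INF x\<in>A. f x)"
proof (cases "c = 0")
  case True
  then show ?thesis using assms by simp
next
  case False
  have "(INF x\<in>A. c * f x) / c \<le> (INF x\<in>A. f x)"
    using False by (intro INF_greatest divide_le_posI_ennreal INF_lower) (auto simp: zero_less_iff_neq_zero)
  then have "c * ((INF x\<in>A. c * f x) / c) \<le> c * (INF x\<in>A. f x)"
    by (rule mult_left_mono) simp
  moreover have "c * ((INF x\<in>A. c * f x) / c) = (INF x\<in>A. c * f x)"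
    unfolding ennreal_times_divide mult.commute[of c]
    by (rule mult_divide_eq_ennreal[OF False assms(2)])
  moreover have "c * (INF x\<in>A. f x) \<le> (INF x\<in>A. c * f x)"
    by (intro INF_greatest mult_left_mono INF_lower) auto
  ultimately show ?thesis by simp
qed

text \<open>Translation by \<open>c\<close> is monotone and continuous from the right, so it
  commutes with the infimum of a nonempty set.\<close>

lemma INF_add_right_ennreal:
  fixes c :: ennreal
  assumes "A \<noteq> {}"
  shows "(INF x\<in>A. f x + c) = (INF x\<in>A. f x) + c"
  using continuous_at_Inf_mono[of "\<lambda>x. x + c" "f ` A"]
    continuous_add[of "at_right (Inf (f ` A))", of "\<lambda>x. x" "\<lambda>x. c"] assms
  by (auto simp: mono_def image_comp)

text \<open>Pulling the two infima out requires \<open>c\<close> finite and \<open>A\<close> nonempty, because \<open>0 * \<infinity> = 0\<close>.\<close>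

lemma le_mult_INF_add_INF_ennreal:
  fixes c :: ennreal
  assumes "A \<noteq> {}" and "c \<noteq> top"
    and "\<And>x y. x \<in> A \<Longrightarrow> y \<in> B \<Longrightarrow> a \<le> c * f x + g y"
  shows "a \<le> c * (INF x\<in>A. f x) + (INF y\<in>B. g y)"
\<comment> \<open>For empty \<open>B\<close> the second infimum is infinite and the bound is
  trivial.\<close>
proof (cases "B = {}")
  case True
  then show ?thesis by simp
next
  case False
  have "a \<le> (INF x\<in>A. c * f x + (INF y\<in>B. g y))"
  proof (rule INF_greatest)
    fix x assume "x \<in> A"
    then have "a \<le> (INF y\<in>B. c * f x + g y)"
      using assms(3) by (intro INF_greatest)
    also have "\<dots> = c * f x + (INF y\<in>B. g y)"
      using INF_add_right_ennreal[OF False, of g "c * f x"] by (simp add: add.commute)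
    finally show "a \<le> c * f x + (INF y\<in>B. g y)" .
  qed
  also have "\<dots> = c * (INF x\<in>A. f x) + (INF y\<in>B. g y)"
    using assms(1,2) by (simp add: INF_add_right_ennreal INF_mult_left_ennreal)
  finally show ?thesis .
qed

context vector_space
begin

lemma finite_basis_of_finite_span:
  assumes "finite S" and "span S = W"
  obtains B where "finite B" and "span B = W" and "card B = dim W"
proof -
  obtain B where B: "B \<subseteq> W" "independent B" "W \<subseteq> span B" "card B = dim W"
    using basis_exists[of W] by blast
  \<comment> \<open>The cardinality equation alone would not give this, since \<open>card\<close> is
    0 on infinite sets; an independent set inside a finitely generated span is finite.\<close>
  have "finite B"
    using independent_span_bound[OF assms(1) B(2)] B(1) assms(2) by simp
  moreover have "span B = W"
    using B(1,3) assms(2) by (metis span_span span_mono subset_antisym)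
  ultimately show thesis using that B(4) by blast
qed

end

context
  fixes scl :: "'k::real_normed_field \<Rightarrow> 'z::banach \<Rightarrow> 'z"
  assumes scl: "vector_space scl"
begin

interpretation vector_space scl by (rule scl)

text \<open>Counting generators instead of computing dimensions makes sums and linear images easy:
  take the union or the image of the generating sets.\<close>

lemma lin_subspaces_iff:
  "W \<in> lin_subspaces scl n \<longleftrightarrow> (\<exists>B. finite B \<and> card B \<le> n \<and> span B = W)"
proof
  assume "W \<in> lin_subspaces scl n"
  then show "\<exists>B. finite B \<and> card B \<le> n \<and> span B = W"
    unfolding lin_subspaces_def using finite_basis_of_finite_span by (smt (verit) mem_Collect_eq)
next
  assume "\<exists>B. finite B \<and> card B \<le> n \<and> span B = W"
  then obtain B where "finite B" "card B \<le> n" "span B = W" by blast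
  then show "W \<in> lin_subspaces scl n"
    unfolding lin_subspaces_def using dim_le_card[of W B] subspace_span[of B] by auto
qed

lemma zero_mem_lin_subspaces: "W \<in> lin_subspaces scl n \<Longrightarrow> 0 \<in> W"
  unfolding lin_subspaces_def by (simp add: subspace_0)

text \<open>Needed to pull the factor \<open>onorm \<pi>0\<close>, possibly 0, out of the infimum
  over \<open>W\<close>.\<close>

lemma aff_subspaces_nonempty: "aff_subspaces scl n \<noteq> {}"
proof -
  have "span {} \<in> lin_subspaces scl n"
    unfolding lin_subspaces_iff by (intro exI[of _ "{}"]) auto
  then show ?thesis unfolding aff_subspaces_def by blast
qed

lemma lin_subspaces_sum:
  assumes "V \<in> lin_subspaces scl n" and "W \<in> lin_subspaces scl m"
  shows "{v + w | v w. v \<in> V \<and> w \<in> W} \<in> lin_subspaces scl (n + m)"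
proof -
  obtain B C where B: "finite B" "card B \<le> n" "span B = V"
    and C: "finite C" "card C \<le> m" "span C = W"
    using assms unfolding lin_subspaces_iff by blast
  have "card (B \<union> C) \<le> n + m"
    using card_Un_le[of B C] B(2) C(2) by linarith
  moreover have "span (B \<union> C) = {v + w | v w. v \<in> V \<and> w \<in> W}"
    unfolding span_Un using B(3) C(3) by auto
  ultimately show ?thesis
    unfolding lin_subspaces_iff using B(1) C(1) by blast
qed

end

lemma lin_subspaces_image:
  assumes f: "Vector_Spaces.linear scaleX scaleY f"
    and W: "W \<in> lin_subspaces scaleX n"
  shows "f ` W \<in> lin_subspaces scaleY n"
proof -
  interpret f: Vector_Spaces.linear scaleX scaleY f by (rule f)
  obtain B where B: "finite B" "card B \<le> n" "f.vs1.span B = W"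
    using W unfolding lin_subspaces_iff[OF f.vs1.vector_space_axioms] by blast
  have "card (f ` B) \<le> n"
    using card_image_le[OF B(1), of f] B(2) by linarith
  then show ?thesis
    unfolding lin_subspaces_iff[OF f.vs2.vector_space_axioms]
    using B(1,3) f.span_image[of B] by blast
qed

theorem theorem3p3:
  fixes scaleX :: "'k::real_normed_field \<Rightarrow> 'x::banach \<Rightarrow> 'x"
    and scaleY :: "'k \<Rightarrow> 'y::banach \<Rightarrow> 'y"
    and \<pi> \<pi>0 F :: "'x \<Rightarrow> 'y" and l0 :: 'y
    and K :: "'x set" and n m :: nat
  assumes "banach_over scaleX" and "banach_over scaleY"
    and "Vector_Spaces.linear scaleX scaleY \<pi>0" and "bounded_linear \<pi>0"
    and "\<And>x. \<pi> x = l0 + \<pi>0 x + F x"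
    and "K \<noteq> {}" and "n \<ge> 1" and "m \<ge> 1"
  shows "affine_kolmogorov_width scaleY (n + m) (\<pi> ` K)
    \<le> ennreal (onorm \<pi>0) * affine_kolmogorov_width scaleX n K
      + kolmogorov_width scaleY m (F ` K)"
proof -
  have X: "vector_space scaleX" and Y: "vector_space scaleY"
    using assms(1,2) by (simp_all add: banach_over_def)
  interpret bounded_linear \<pi>0 by (rule assms(4))
  show ?thesis
    unfolding affine_kolmogorov_width_def[of scaleX] kolmogorov_width_def
  proof (rule le_mult_INF_add_INF_ennreal[OF aff_subspaces_nonempty[OF X]])
    fix W V
    assume "W \<in> aff_subspaces scaleX n" and V: "V \<in> lin_subspaces scaleY m"
    then obtain c W0 where W: "W = (+) c ` W0" and W0: "W0 \<in> lin_subspaces scaleX n"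
      unfolding aff_subspaces_def by blast
    \<comment> \<open>\<open>U\<close> consists of all \<open>l0 + \<pi>0 \<xi> + \<eta>\<close>
      with \<open>\<xi>\<close> in \<open>W\<close> and \<open>\<eta>\<close> in \<open>V\<close>,
      written as a translate so that its dimension can be read off.\<close>
    define U where "U = (+) (l0 + \<pi>0 c) ` {v + w | v w. v \<in> \<pi>0 ` W0 \<and> w \<in> V}"
    have "U \<in> aff_subspaces scaleY (n + m)"
      unfolding U_def aff_subspaces_def
      using lin_subspaces_sum[OF Y lin_subspaces_image[OF assms(3) W0] V] by blast
    moreover have memU: "l0 + \<pi>0 \<xi> + \<eta> \<in> U" if "\<xi> \<in> W" "\<eta> \<in> V" for \<xi> \<eta>
      using that unfolding U_def W by (force simp: add)
    let ?E = "\<lambda>S x. INF \<xi>\<in>S. ennreal (norm (x - \<xi>))"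
    have "(SUP y\<in>\<pi> ` K. ?E U y)
        \<le> ennreal (onorm \<pi>0) * (SUP x\<in>K. ?E W x) + (SUP y\<in>F ` K. ?E V y)"
    proof (rule SUP_least)
      fix y assume "y \<in> \<pi> ` K"
      then obtain x where x: "x \<in> K" "y = \<pi> x" by blast
      have "W \<noteq> {}"
        using W W0 zero_mem_lin_subspaces[OF X] by blast
      \<comment> \<open>Here \<open>x\<close> is fixed and the infima run over the points of
        \<open>W\<close> and \<open>V\<close>; the outer use of the same rule runs over the spaces
        themselves.\<close>
      then have "?E U y \<le> ennreal (onorm \<pi>0) * ?E W x + ?E V (F x)"
      proof (rule le_mult_INF_add_INF_ennreal)
        fix \<xi> \<eta> assume "\<xi> \<in> W" "\<eta> \<in> V"
        \<comment> \<open>The constant \<open>l0\<close> cancels and linearity merges the two values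
          of \<open>\<pi>0\<close>.\<close>
        have "y - (l0 + \<pi>0 \<xi> + \<eta>) = \<pi>0 (x - \<xi>) + (F x - \<eta>)"
          by (simp add: x(2) assms(5) diff)
        moreover have "norm (\<pi>0 (x - \<xi>) + (F x - \<eta>))
            \<le> onorm \<pi>0 * norm (x - \<xi>) + norm (F x - \<eta>)"
          by (rule norm_triangle_le) (simp add: onorm[OF assms(4)])
        ultimately have "norm (y - (l0 + \<pi>0 \<xi> + \<eta>))
            \<le> onorm \<pi>0 * norm (x - \<xi>) + norm (F x - \<eta>)"
          by (simp only:)
        then have "ennreal (norm (y - (l0 + \<pi>0 \<xi> + \<eta>)))
            \<le> ennreal (onorm \<pi>0) * ennreal (norm (x - \<xi>)) + ennreal (norm (F x - \<eta>))"
          by (simp add: ennreal_leI onorm_pos_le[OF assms(4)] flip: ennreal_mult ennreal_plus)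
        then show "?E U y \<le> ennreal (onorm \<pi>0) * ennreal (norm (x - \<xi>))
            + ennreal (norm (F x - \<eta>))"
          using memU[OF \<open>\<xi> \<in> W\<close> \<open>\<eta> \<in> V\<close>] by (rule INF_lower2[rotated])
      qed simp
      also have "\<dots> \<le> ennreal (onorm \<pi>0) * (SUP x\<in>K. ?E W x) + (SUP y\<in>F ` K. ?E V y)"
        using x(1) by (intro add_mono mult_left_mono SUP_upper) auto
      finally show "?E U y \<le> \<dots>" .
    qed
    ultimately show "affine_kolmogorov_width scaleY (n + m) (\<pi> ` K)
        \<le> ennreal (onorm \<pi>0) * (SUP x\<in>K. ?E W x) + (SUP y\<in>F ` K. ?E V y)"
      unfolding affine_kolmogorov_width_def by (rule INF_lower2)
  qed simp
qed

end
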